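(* Let $G=(V,E)$ be a DAG task and let $m\ge 1$ be an integer. Let $k\in[0,m-1]$ be an integer and let $(\lambda_i)_0^k=(\lambda_0,\dots,\lambda_k)$ be a generalized path list of $G$ in which $\lambda_0$ is the longest path of $G$. Then the response time $R$ of $G$ in any execution sequence under work-conserving scheduling on $m$ cores satisfies $$R\le \min_{j\in[0,k]}\left\{ len(G)+\frac{vol(G)-\sum_{i=0}^{j} len(\lambda_i)}{m-j}\right\}.$$
   Context: **DAG task.** $G=(V,E)$ is a finite directed acyclic graph with exactly one source vertex $v_{src}$ (no incoming edges) and exactly one sink vertex $v_{snk}$ (no outgoing edges). Each vertex $v$ has a worst-case execution time (WCET) $c(v)$, a nonnegative integer. $pre(v)=\{u:(u,v)\in E\}$. For a set (or path) $V'$ of vertices, $vol(V')=len(V')=\sum_{v\in V'}c(v)$; $vol(G)=vol(V)$. A path is a sequence $(\pi_0,\dots,\pi_r)$ with $(\pi_i,\pi_{i+1})\in E$; it is complete if $\pi_0=v_{src}$ and $\pi_r=v_{snk}$. "The longest path" of $G$ is a complete path of maximal length; its length is $len(G)$. **Generalized path list.** A generalized path is a sequence of vertices $(\pi_0,\dots,\pi_r)$ such that for every $i\in[0,r-1]$ there is a path in $G$ from $\pi_i$ to $\pi_{i+1}$ (a single vertex is a generalized path). A generalized path list $(\lambda_i)_0^k$ is a list of pairwise disjoint generalized paths (disjoint as vertex sets). **Execution.** Time is discrete; a time unit is $\delta=[t,t+1]$ with $t\in\mathbb{N}$, with start $s(\delta)=t$ and finish $f(\delta)=t+1$. In an execution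 sequence of $G$ on $m$ identical cores $P_0,\dots,P_{m-1}$, each vertex $v$ has an execution time $e(v)$, an integer with $0\le e(v)\le c(v)$, and executes in exactly $e(v)$ time units (preemption and migration are allowed); in each time unit a vertex executes on at most one core and a core executes at most one vertex (a core executing no vertex is idle, otherwise busy). $s(v)$ and $f(v)$ are the start of the first and the finish of the last time unit in which $v$ executes; if $e(v)=0$ then $v$ has a time point $s(v)=f(v)\in\mathbb{N}$. Precedence: $s(v)\ge f(u)$ for all $(u,v)\in E$. The source starts at time $0$: $s(v_{src})=0$. The scheduling is work-conserving: for every vertex $v$ and time unit $\delta$ with $f(u)\le s(\delta)$ for all $u\in pre(v)$ and $f(\delta)\le f(v)$, either $v$ executes in $\delta$ or all $m$ cores are busy in $\delta$. The response time in the execution sequence is $R=f(v_{snk})$. *)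

theory Defs
  imports Complex_Main "HOL-Library.Disjoint_Sets"
begin

record 'a dag =
  verts :: "'a set"
  edges :: "('a \<times> 'a) set"
  wcet :: "'a \<Rightarrow> nat"
  src :: 'a
  snk :: 'a

locale dag_task =
  fixes G :: "'a dag"
  assumes finite_verts: "finite (verts G)"
    and edges_subset: "edges G \<subseteq> verts G \<times> verts G"
    and acyclic_edges: "acyclic (edges G)"
    and unique_source: "{v \<in> verts G. \<forall>u. (u, v) \<notin> edges G} = {src G}"
    and unique_sink: "{v \<in> verts G. \<forall>w. (v, w) \<notin> edges G} = {snk G}"

definition pre :: "'a dag \<Rightarrow> 'a \<Rightarrow> 'a set" where
  "pre G v = {u. (u, v) \<in> edges G}"

definition vol :: "'a dag \<Rightarrow> 'a set \<Rightarrow> nat" where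
  "vol G W = (\<Sum>v\<in>W. wcet G v)"

text \<open>The length of a sequence is the volume of its vertex set, so a vertex that occurs
  several times is counted once.\<close>

definition len :: "'a dag \<Rightarrow> 'a list \<Rightarrow> nat" where
  "len G p = vol G (set p)"

definition is_path :: "'a dag \<Rightarrow> 'a list \<Rightarrow> bool" where
  "is_path G p \<longleftrightarrow>
     p \<noteq> [] \<and> set p \<subseteq> verts G \<and> successively (\<lambda>u v. (u, v) \<in> edges G) p"

definition complete_path :: "'a dag \<Rightarrow> 'a list \<Rightarrow> bool" where
  "complete_path G p \<longleftrightarrow> is_path G p \<and> hd p = src G \<and> last p = snk G"

definition longest_path :: "'a dag \<Rightarrow> 'a list \<Rightarrow> bool" where
  "longest_path G p \<longleftrightarrow> is_arg_max (len G) (complete_path G) p"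

text \<open>The set below is finite because all its elements are bounded by the volume of the
  graph, and nonempty because a finite acyclic graph with a unique source and a unique sink
  has a complete path.\<close>

definition len_dag :: "'a dag \<Rightarrow> nat" where
  "len_dag G = Max {len G p |p. complete_path G p}"

definition generalized_path :: "'a dag \<Rightarrow> 'a list \<Rightarrow> bool" where
  "generalized_path G p \<longleftrightarrow>
     p \<noteq> [] \<and> set p \<subseteq> verts G \<and>
     successively (\<lambda>u v. \<exists>q. is_path G q \<and> hd q = u \<and> last q = v) p"

text \<open>The list consists of \<open>ps 0, \<dots>, ps k\<close>; the values of \<open>ps\<close> beyond \<open>k\<close> are irrelevant.\<close>

definition generalized_path_list :: "'a dag \<Rightarrow> nat \<Rightarrow> (nat \<Rightarrow> 'a list) \<Rightarrow> bool" where
  "generalized_path_list G k ps \<longleftrightarrow>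
     (\<forall>i\<le>k. generalized_path G (ps i)) \<and> disjoint_family_on (\<lambda>i. set (ps i)) {..k}"

text \<open>The time unit \<open>[t, t + 1]\<close> is represented by its start \<open>t\<close>. The value \<open>runs X i t\<close> is the
  vertex that core \<open>i\<close> executes in time unit \<open>t\<close>, or \<open>None\<close> if the core is idle. The start and
  finish times are components of their own because they are not determined by \<open>runs\<close> for
  vertices with execution time 0.\<close>

record 'a exec_seq =
  runs :: "nat \<Rightarrow> nat \<Rightarrow> 'a option"
  etime :: "'a \<Rightarrow> nat"
  start :: "'a \<Rightarrow> nat"
  finish :: "'a \<Rightarrow> nat"

definition exec_units :: "'a exec_seq \<Rightarrow> nat \<Rightarrow> 'a \<Rightarrow> nat set" where
  "exec_units X m v = {t. \<exists>i<m. runs X i t = Some v}"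

locale execution =
  fixes G :: "'a dag" and m :: nat and X :: "'a exec_seq"
  assumes runs_verts: "i < m \<Longrightarrow> runs X i t = Some v \<Longrightarrow> v \<in> verts G"
    and one_core:
      "i < m \<Longrightarrow> j < m \<Longrightarrow> runs X i t = Some v \<Longrightarrow> runs X j t = Some v \<Longrightarrow> i = j"
    and etime_le: "v \<in> verts G \<Longrightarrow> etime X v \<le> wcet G v"
    and finite_units: "v \<in> verts G \<Longrightarrow> finite (exec_units X m v)"
    and card_units: "v \<in> verts G \<Longrightarrow> card (exec_units X m v) = etime X v"
    and start_eq: "v \<in> verts G \<Longrightarrow> etime X v > 0 \<Longrightarrow> start X v = Min (exec_units X m v)"
    and finish_eq: "v \<in> verts G \<Longrightarrow> etime X v > 0 \<Longrightarrow> finish X v = Max (exec_units X m v) + 1"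
    and zero_time: "v \<in> verts G \<Longrightarrow> etime X v = 0 \<Longrightarrow> start X v = finish X v"
    and precedence: "(u, v) \<in> edges G \<Longrightarrow> finish X u \<le> start X v"
    and start_src: "start X (src G) = 0"

locale work_conserving_execution = execution +
  assumes work_conserving:
    "v \<in> verts G \<Longrightarrow> (\<And>u. u \<in> pre G v \<Longrightarrow> finish X u \<le> t) \<Longrightarrow> t + 1 \<le> finish X v \<Longrightarrow>
       t \<in> exec_units X m v \<or> (\<forall>i<m. runs X i t \<noteq> None)"

definition response_time :: "'a dag \<Rightarrow> 'a exec_seq \<Rightarrow> nat" where
  "response_time G X = finish X (snk G)"

end

theory Submission
  imports Defs
begin

text \<open>Fix \<open>j\<close>, write \<open>L\<close> for the length of the graph, \<open>R\<close> for the response time and \<open>\<Lambda>\<close>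
  for the set of all vertices on \<open>\<lambda>\<^sub>0, \<dots>, \<lambda>\<^sub>j\<close>.
  Let \<open>I\<close> be the set of time units before \<open>R\<close> in which some core is idle, and \<open>J\<close> the set of
  those in which either all of \<open>\<lambda>\<^sub>0, \<dots>, \<lambda>\<^sub>j\<close> execute, or some core is idle and only vertices of
  \<open>\<Lambda>\<close> execute. Going backwards in time one finds, for each of \<open>I\<close> and \<open>J\<close>, a single path
  that executes in all of its time units: when a core is idle, every unfinished vertex has an
  executing ancestor (or executes itself); when all \<open>\<lambda>\<^sub>i\<close> execute, an unfinished
  vertex of \<open>\<lambda>\<^sub>i\<close> is preceded by (or equal to) the executing vertex of \<open>\<lambda>\<^sub>i\<close>, and the path for
  \<open>J\<close> never has to leave \<open>\<Lambda>\<close>. Hence \<open>|I| \<le> L\<close> and \<open>|J| \<le> L\<close>. In each time unit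
  the number of executing vertices outside \<open>\<Lambda>\<close> is at least \<open>m - j\<close> outside \<open>I\<close> and at least 1 in
  \<open>I\<close>, with one less allowed in \<open>J\<close>. Summing over time,
  \<open>(m - j) (R - |I|) + |I| - |J|\<close> is at most the volume outside \<open>\<Lambda>\<close>, and \<open>m - j \<ge> 1\<close> yields
  the bound.\<close>

section \<open>Paths, reachability and generalized paths\<close>

lemma is_path_append:
  assumes "is_path G q" "is_path G p" "last q = hd p"
  shows "is_path G (q @ tl p)" "hd (q @ tl p) = hd q" "last (q @ tl p) = last p"
    "set (q @ tl p) = set q \<union> set p"
proof -
  obtain x p' where p: "p = x # p'"
    using assms(2) by (cases p) (auto simp: is_path_def)
  have q: "q \<noteq> []" and x: "x \<in> set q"
    using assms(1,3) p last_in_set by (fastforce simp: is_path_def)+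
  show "is_path G (q @ tl p)"
    using assms p q by (cases p') (auto simp: is_path_def successively_append_iff)
  show "hd (q @ tl p) = hd q" "last (q @ tl p) = last p" "set (q @ tl p) = set q \<union> set p"
    using assms(3) p q x by auto
qed

lemma rtrancl_imp_path:
  assumes "(u, v) \<in> (edges G)\<^sup>*" "edges G \<subseteq> verts G \<times> verts G" "v \<in> verts G"
  obtains q where "is_path G q" "hd q = u" "last q = v"
proof -
  have "\<exists>q. is_path G q \<and> hd q = u \<and> last q = v"
    using assms(1)
  proof (induction rule: converse_rtrancl_induct)
    case base
    then show ?case
      using assms(3) by (intro exI[of _ "[v]"]) (auto simp: is_path_def)
  next
    case (step u w)
    then obtain q where q: "is_path G q" "hd q = w" "last q = v"
      by blast
    then have "is_path G (u # q) \<and> hd (u # q) = u \<and> last (u # q) = v"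
      using step.hyps(1) assms(2) by (cases q) (auto simp: is_path_def)
    then show ?case
      by blast
  qed
  then show ?thesis
    using that by blast
qed

lemma path_imp_rtrancl:
  assumes "is_path G q"
  shows "(hd q, last q) \<in> (edges G)\<^sup>*"
proof -
  have "successively (\<lambda>u v. (u, v) \<in> edges G) q \<Longrightarrow> q \<noteq> [] \<Longrightarrow> (hd q, last q) \<in> (edges G)\<^sup>*"
    by (induction q rule: induct_list012) (auto intro: converse_rtrancl_into_rtrancl)
  then show ?thesis
    using assms by (auto simp: is_path_def)
qed

text \<open>Reachability is transitive, so relating consecutive entries already relates every
  earlier entry to every later one.\<close>

lemma generalized_path_comparable:
  assumes "generalized_path G p" "u \<in> set p" "v \<in> set p"
  shows "(u, v) \<in> (edges G)\<^sup>* \<or> (v, u) \<in> (edges G)\<^sup>*"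
proof -
  have "successively (\<lambda>u v. (u, v) \<in> (edges G)\<^sup>*) p"
    using assms(1) unfolding generalized_path_def
    by (elim conjE successively_mono) (use path_imp_rtrancl in blast)
  then have "sorted_wrt (\<lambda>u v. (u, v) \<in> (edges G)\<^sup>*) p"
    by (subst (asm) successively_conv_sorted_wrt) (auto intro: transpI)
  then show ?thesis
    using assms(2,3) by (induction p) auto
qed

section \<open>Lengths of paths between the unique source and sink\<close>

context dag_task
begin

lemma finite_edges: "finite (edges G)"
  using finite_subset[OF edges_subset] finite_verts by simp

lemma src_reaches: "v \<in> verts G \<Longrightarrow> (src G, v) \<in> (edges G)\<^sup>*"
proof (induction v rule: wf_induct_rule[OF finite_acyclic_wf[OF finite_edges acyclic_edges]])
  case (1 v)
  show ?case
  proof (cases "v = src G")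
    case False
    then obtain u where "(u, v) \<in> edges G"
      using unique_source 1(2) by blast
    then show ?thesis
      using 1(1)[of u] edges_subset by (auto intro: rtrancl_into_rtrancl)
  qed simp
qed

lemma reaches_snk: "v \<in> verts G \<Longrightarrow> (v, snk G) \<in> (edges G)\<^sup>*"
proof (induction v rule:
    wf_induct_rule[OF finite_acyclic_wf_converse[OF finite_edges acyclic_edges]])
  case (1 v)
  show ?case
  proof (cases "v = snk G")
    case False
    then obtain u where "(v, u) \<in> edges G"
      using unique_sink 1(2) by blast
    then show ?thesis
      using 1(1)[of u] edges_subset by (auto intro: converse_rtrancl_into_rtrancl)
  qed simp
qed

lemma snk_in_verts: "snk G \<in> verts G"
  using unique_sink by auto

lemma len_le_len_dag:
  assumes "complete_path G p"
  shows "len G p \<le> len_dag G"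
proof -
  have "{len G p |p. complete_path G p} \<subseteq> {..vol G (verts G)}"
    using finite_verts by (auto simp: complete_path_def is_path_def len_def vol_def intro!: sum_mono2)
  then have "finite {len G p |p. complete_path G p}"
    using finite_subset by blast
  then show ?thesis
    using assms by (auto simp: len_dag_def intro!: Max_ge)
qed

text \<open>Prepending a path from the source completes the path without losing vertices. This
  serves paths grown backwards from the sink, whose head is arbitrary.\<close>

lemma path_to_snk_len_le:
  assumes "is_path G p" "last p = snk G"
  shows "len G p \<le> len_dag G"
proof -
  have hd: "hd p \<in> verts G"
    using assms(1) by (auto simp: is_path_def)
  obtain q where q: "is_path G q" "hd q = src G" "last q = hd p"
    using rtrancl_imp_path[OF src_reaches[OF hd] edges_subset hd] by blast
  note qp = is_path_append[OF q(1) assms(1) q(3)]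
  have "len G p \<le> len G (q @ tl p)"
    unfolding len_def vol_def using qp(4) by (intro sum_mono2) auto
  also have "\<dots> \<le> len_dag G"
    using qp q(2) assms(2) by (intro len_le_len_dag) (simp add: complete_path_def)
  finally show ?thesis .
qed

end

section \<open>Counting executing vertices\<close>

context execution
begin

lemma executing_imp:
  assumes "t \<in> exec_units X m v"
  shows "v \<in> verts G" "start X v \<le> t" "t < finish X v"
proof -
  show v: "v \<in> verts G"
    using assms runs_verts by (auto simp: exec_units_def)
  have "etime X v > 0"
    using assms finite_units[OF v] card_units[OF v] by (metis card_gt_0_iff empty_iff)
  then show "start X v \<le> t" "t < finish X v"
    using assms start_eq[OF v] finish_eq[OF v] finite_units[OF v] by (auto simp: less_Suc_eq_le)
qed

lemma start_le_finish:
  assumes "v \<in> verts G"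
  shows "start X v \<le> finish X v"
proof (cases "etime X v = 0")
  case True
  then show ?thesis
    using zero_time assms by simp
next
  case False
  then obtain t where "t \<in> exec_units X m v"
    using card_units[OF assms] by fastforce
  then show ?thesis
    using executing_imp[of t v] by simp
qed

text \<open>Double counting of pairs of a time unit and a vertex: per vertex there are at most
  \<open>etime X v\<close> such units.\<close>

lemma sum_card_executing_le:
  assumes "finite W" "W \<subseteq> verts G" "finite T"
  shows "(\<Sum>t\<in>T. card {v\<in>W. t \<in> exec_units X m v}) \<le> vol G W"
proof -
  have "(\<Sum>t\<in>T. card {v\<in>W. t \<in> exec_units X m v}) = (\<Sum>v\<in>W. card {t\<in>T. t \<in> exec_units X m v})"
    using assms by (intro sum_multicount_gen) auto
  also have "\<dots> \<le> (\<Sum>v\<in>W. wcet G v)"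
  proof (rule sum_mono)
    fix v assume "v \<in> W"
    then have v: "v \<in> verts G"
      using assms by auto
    have "card {t\<in>T. t \<in> exec_units X m v} \<le> card (exec_units X m v)"
      using finite_units[OF v] by (intro card_mono) auto
    then show "card {t\<in>T. t \<in> exec_units X m v} \<le> wcet G v"
      using card_units[OF v] etime_le[OF v] by simp
  qed
  finally show ?thesis
    by (simp add: vol_def)
qed

lemma all_busy_card:
  assumes "finite (verts G)" "\<forall>i<m. runs X i t \<noteq> None"
  shows "m \<le> card {v\<in>verts G. t \<in> exec_units X m v}"
proof -
  have "inj_on (\<lambda>i. the (runs X i t)) {..<m}"
    using assms(2) one_core by (intro inj_onI) (metis lessThan_iff option.collapse)
  moreover have "(\<lambda>i. the (runs X i t)) ` {..<m} \<subseteq> {v\<in>verts G. t \<in> exec_units X m v}"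
    using assms(2) runs_verts by (fastforce simp: exec_units_def)
  ultimately show ?thesis
    using card_inj_on_le[of _ "{..<m}"] assms(1) by fastforce
qed

end

section \<open>Executing ancestors and backward chains\<close>

locale dag_execution = dag_task G + work_conserving_execution G m X
  for G :: "'a dag" and m :: nat and X :: "'a exec_seq"
begin

lemma finish_le_start:
  assumes "(u, v) \<in> (edges G)\<^sup>+"
  shows "finish X u \<le> start X v"
  using assms
proof (induction rule: trancl_induct)
  case (step v w)
  then show ?case
    using precedence[of v w] start_le_finish[of v] edges_subset by fastforce
qed (rule precedence)

text \<open>If all predecessors have finished, work conservation and the idle core force
  \<open>v\<close> itself to execute. Otherwise the induction descends to an unfinished
  predecessor.\<close>

lemma idle_executing_ancestor:
  assumes idle: "\<exists>i<m. runs X i t = None"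
    and "v \<in> verts G" "t < finish X v"
  shows "\<exists>u. t \<in> exec_units X m u \<and> (u, v) \<in> (edges G)\<^sup>*"
  using assms(2,3)
proof (induction v rule: wf_induct_rule[OF finite_acyclic_wf[OF finite_edges acyclic_edges]])
  case (1 v)
  show ?case
  proof (cases "\<forall>u\<in>pre G v. finish X u \<le> t")
    case True
    then have "t \<in> exec_units X m v"
      using work_conserving[of v t] 1 idle by auto
    then show ?thesis
      by blast
  next
    case False
    then obtain u where u: "(u, v) \<in> edges G" "t < finish X u"
      by (auto simp: pre_def not_le)
    then obtain w where "t \<in> exec_units X m w" "(w, u) \<in> (edges G)\<^sup>*"
      using 1(1)[of u] edges_subset by blast
    then show ?thesis
      using u(1) by (meson rtrancl_into_rtrancl)
  qed
qed

text \<open>Both vertices are comparable. If \<open>v\<close> strictly preceded \<open>w\<close>, it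
  would have finished before \<open>w\<close> started.\<close>

lemma executing_before_unfinished:
  assumes "generalized_path G p" "v \<in> set p" "w \<in> set p"
    and "t \<in> exec_units X m w" "t < finish X v"
  shows "(w, v) \<in> (edges G)\<^sup>*"
proof (rule ccontr)
  assume "(w, v) \<notin> (edges G)\<^sup>*"
  then have "(v, w) \<in> (edges G)\<^sup>+"
    using generalized_path_comparable[OF assms(1-3)] by (auto simp: rtrancl_eq_or_trancl)
  then show False
    using finish_le_start[of v w] executing_imp(2)[OF assms(4)] assms(5) by simp
qed

text \<open>Two executing vertices are both unfinished, so each reaches the other, and acyclicity
  identifies them.\<close>

lemma card_executing_generalized_path:
  assumes "generalized_path G p"
  shows "card {v\<in>set p. t \<in> exec_units X m v} \<le> 1"
proof -
  have "u = v" if "u \<in> set p" "v \<in> set p" "t \<in> exec_units X m u" "t \<in> exec_units X m v" for u v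
  proof -
    have "(u, v) \<in> (edges G)\<^sup>*" "(v, u) \<in> (edges G)\<^sup>*"
      using executing_before_unfinished[OF assms] executing_imp(3) that by blast+
    then show ?thesis
      using acyclic_edges by (metis acyclic_def rtranclD trancl_trans)
  qed
  then show ?thesis
    using card_le_Suc0_iff_eq[of "{v\<in>set p. t \<in> exec_units X m v}"] by auto
qed

text \<open>A path ending in the sink is grown backwards in time until its vertices cover all units
  of \<open>T\<close>. Only the vertices chosen to execute lie in \<open>W\<close>; the connecting
  paths may leave it.\<close>

lemma card_times_le_len_dag:
  assumes "finite T"
    and some: "\<And>t. t \<in> T \<Longrightarrow> \<exists>u\<in>W. t \<in> exec_units X m u"
    and ancestor: "\<And>t v. t \<in> T \<Longrightarrow> v \<in> W \<Longrightarrow> t < finish X v \<Longrightarrow>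
      \<exists>u\<in>W. t \<in> exec_units X m u \<and> (u, v) \<in> (edges G)\<^sup>*"
  shows "card T \<le> len_dag G"
proof (cases "T = {}")
  case False
  \<comment> \<open>The conditions on \<open>hd p\<close> carry the induction: a head that executes
    at \<open>Min T\<close> is unfinished in any earlier unit, so \<open>ancestor\<close> applies to
    it.\<close>
  have "\<exists>p. is_path G p \<and> last p = snk G \<and> hd p \<in> W \<and> Min T \<in> exec_units X m (hd p) \<and>
    T \<subseteq> (\<Union>v\<in>set p. exec_units X m v)"
    using assms(1) False some ancestor
  proof (induction T rule: finite_linorder_min_induct)
    case (insert t T)
    have min: "Min (insert t T) = t"
      using insert.hyps by (intro Min_eqI) auto
    \<comment> \<open>For empty \<open>T\<close> the path is \<open>[snk G]\<close>, and the sink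
      need not execute in any unit considered.\<close>
    have "\<exists>p u. u \<in> W \<and> t \<in> exec_units X m u \<and> is_path G p \<and> last p = snk G \<and> (u, hd p) \<in> (edges G)\<^sup>* \<and>
      T \<subseteq> (\<Union>v\<in>set p. exec_units X m v)"
    proof (cases "T = {}")
      case True
      obtain u where u: "u \<in> W" "t \<in> exec_units X m u"
        using insert.prems(2)[of t] by auto
      then have "(u, snk G) \<in> (edges G)\<^sup>*"
        using reaches_snk executing_imp(1) by blast
      then show ?thesis
        using u True snk_in_verts
        by (intro exI[of _ "[snk G]"] exI[of _ u]) (auto simp: is_path_def)
    next
      case False
      then obtain p where p: "is_path G p" "last p = snk G" "hd p \<in> W"
        "Min T \<in> exec_units X m (hd p)" "T \<subseteq> (\<Union>v\<in>set p. exec_units X m v)"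
        using insert.IH insert.prems by blast
      have "t < Min T"
        using insert.hyps False by simp
      then have "t < finish X (hd p)"
        using executing_imp(3)[OF p(4)] by simp
      then show ?thesis
        using insert.prems(3)[of t "hd p"] p by blast
    qed
    then obtain p u where p: "u \<in> W" "t \<in> exec_units X m u" "is_path G p" "last p = snk G"
        "(u, hd p) \<in> (edges G)\<^sup>*" "T \<subseteq> (\<Union>v\<in>set p. exec_units X m v)"
      by blast
    have "hd p \<in> verts G"
      using p(3) by (auto simp: is_path_def)
    then obtain q where q: "is_path G q" "hd q = u" "last q = hd p"
      using rtrancl_imp_path[OF p(5) edges_subset] by blast
    note qp = is_path_append[OF q(1) p(3) q(3)]
    have "u \<in> set q"
      using q by (auto simp: is_path_def)
    then show ?case
      using qp q(2) p min by (intro exI[of _ "q @ tl p"]) auto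
  qed simp
  then obtain p where p: "is_path G p" "last p = snk G" "T \<subseteq> (\<Union>v\<in>set p. exec_units X m v)"
    by blast
  have sub: "set p \<subseteq> verts G"
    using p(1) by (simp add: is_path_def)
  have "card T \<le> card (\<Union>v\<in>set p. exec_units X m v)"
    using p(3) sub finite_units by (intro card_mono) auto
  also have "\<dots> \<le> (\<Sum>v\<in>set p. card (exec_units X m v))"
    by (rule card_UN_le) simp
  also have "\<dots> \<le> (\<Sum>v\<in>set p. wcet G v)"
    using sub card_units etime_le by (intro sum_mono) (metis subsetD)
  also have "\<dots> = len G p"
    by (simp add: len_def vol_def)
  also have "\<dots> \<le> len_dag G"
    using path_to_snk_len_le p by blast
  finally show ?thesis .
qed simp

section \<open>The bound for a fixed number of generalized paths\<close>

lemma response_time_bound: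
  assumes gpl: "generalized_path_list G j ps" and "j < m"
  shows "(int m - int j) * (int (response_time G X) - int (len_dag G)) \<le>
    int (vol G (verts G)) - (\<Sum>i=0..j. int (len G (ps i)))"
proof -
  define R where "R = response_time G X"
  define \<Lambda> where "\<Lambda> = (\<Union>i\<le>j. set (ps i))"
  define Ex where "Ex t = {v. t \<in> exec_units X m v}" for t
  define idle where "idle t \<longleftrightarrow> (\<exists>i<m. runs X i t = None)" for t
  define I where "I = {t. t < R \<and> idle t}"
  define J where "J = {t. t < R \<and> (idle t \<and> Ex t \<subseteq> \<Lambda> \<or> (\<forall>i\<le>j. Ex t \<inter> set (ps i) \<noteq> {}))}"
  have gp: "generalized_path G (ps i)" if "i \<le> j" for i
    using gpl that by (simp add: generalized_path_list_def)
  have Lam: "\<Lambda> \<subseteq> verts G"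
    using gp by (auto simp: \<Lambda>_def generalized_path_def)
  have ExV: "Ex t \<subseteq> verts G" for t
    using executing_imp(1) by (auto simp: Ex_def)
  then have finEx: "finite (Ex t)" for t
    using finite_verts finite_subset by blast
  have anc: "\<exists>u\<in>Ex t. (u, snk G) \<in> (edges G)\<^sup>*" if "idle t" "t < R" for t
    using idle_executing_ancestor[of t "snk G"] that snk_in_verts
    by (auto simp: idle_def R_def response_time_def Ex_def)
  have I: "card I \<le> len_dag G"
  proof (rule card_times_le_len_dag[where W = "verts G"])
    show "\<exists>u\<in>verts G. t \<in> exec_units X m u" if "t \<in> I" for t
      using anc[of t] ExV[of t] that by (auto simp: I_def Ex_def)
    show "\<exists>u\<in>verts G. t \<in> exec_units X m u \<and> (u, v) \<in> (edges G)\<^sup>*"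
      if "t \<in> I" "v \<in> verts G" "t < finish X v" for t v
      using idle_executing_ancestor[of t v] executing_imp(1) that
      by (auto simp: I_def idle_def)
  qed (simp add: I_def)
  have J: "card J \<le> len_dag G"
  proof (rule card_times_le_len_dag[where W = \<Lambda>])
    show "\<exists>u\<in>\<Lambda>. t \<in> exec_units X m u" if "t \<in> J" for t
    proof (cases "\<forall>i\<le>j. Ex t \<inter> set (ps i) \<noteq> {}")
      case True
      then have "Ex t \<inter> set (ps 0) \<noteq> {}"
        by blast
      then show ?thesis
        by (auto simp: \<Lambda>_def Ex_def)
    next
      case False
      then show ?thesis
        using anc[of t] that by (auto simp: J_def Ex_def)
    qed
    \<comment> \<open>If all paths execute, the ancestor is taken on the path of \<open>v\<close>.
      Otherwise a core is idle, and the executing ancestor lies in \<Lambda> because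
      \<open>Ex t\<close> does.\<close>
    show "\<exists>u\<in>\<Lambda>. t \<in> exec_units X m u \<and> (u, v) \<in> (edges G)\<^sup>*"
      if "t \<in> J" "v \<in> \<Lambda>" "t < finish X v" for t v
    proof (cases "\<forall>i\<le>j. Ex t \<inter> set (ps i) \<noteq> {}")
      case True
      obtain i where i: "i \<le> j" "v \<in> set (ps i)"
        using \<open>v \<in> \<Lambda>\<close> by (auto simp: \<Lambda>_def)
      then obtain w where w: "w \<in> set (ps i)" "t \<in> exec_units X m w"
        using True by (auto simp: Ex_def)
      then show ?thesis
        using executing_before_unfinished[OF gp[OF i(1)] i(2) w(1,2) that(3)] i(1)
        by (auto simp: \<Lambda>_def)
    next
      case False
      then show ?thesis
        using idle_executing_ancestor[of t v] that Lam by (auto simp: J_def Ex_def idle_def)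
    qed
  qed (simp add: J_def)
  have unit: "(int m - int j) * (1 - of_bool (t \<in> I)) + of_bool (t \<in> I) - of_bool (t \<in> J)
    \<le> int (card (Ex t - \<Lambda>))" if "t < R" for t
  proof (cases "t \<in> I")
    case True
    have "t \<in> J \<or> Ex t - \<Lambda> \<noteq> {}"
      using True by (auto simp: I_def J_def)
    then show ?thesis
      using True finEx[of t] card_gt_0_iff[of "Ex t - \<Lambda>"] by auto
  next
    case False
    have "{v \<in> verts G. t \<in> exec_units X m v} = Ex t"
      using ExV by (auto simp: Ex_def)
    then have busy: "m \<le> card (Ex t)"
      using all_busy_card[of t] finite_verts False that by (auto simp: I_def idle_def)
    \<comment> \<open>Each of the \<open>j + 1\<close> paths contributes at most one executing
      vertex, and the count \<open>j + 1\<close> requires all of them to execute, that is,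
      \<open>t \<in> J\<close>.\<close>
    have "card (Ex t \<inter> \<Lambda>) = card (\<Union>i\<le>j. Ex t \<inter> set (ps i))"
      by (rule arg_cong[where f = card]) (auto simp: \<Lambda>_def)
    also have "\<dots> \<le> (\<Sum>i\<le>j. card (Ex t \<inter> set (ps i)))"
      by (rule card_UN_le) simp
    also have "\<dots> \<le> (\<Sum>i\<le>j. of_bool (Ex t \<inter> set (ps i) \<noteq> {}))"
    proof (rule sum_mono)
      fix i assume "i \<in> {..j}"
      moreover have "Ex t \<inter> set (ps i) = {v\<in>set (ps i). t \<in> exec_units X m v}"
        by (auto simp: Ex_def)
      ultimately show "card (Ex t \<inter> set (ps i)) \<le> of_bool (Ex t \<inter> set (ps i) \<noteq> {})"
        using card_executing_generalized_path[OF gp, of i t] by auto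
    qed
    also have "\<dots> = card {i. i \<le> j \<and> Ex t \<inter> set (ps i) \<noteq> {}}"
      by (simp add: of_bool_def sum.If_cases Int_def)
    also have "\<dots> \<le> j + of_bool (t \<in> J)"
    proof (cases "t \<in> J")
      case True
      have "card {i. i \<le> j \<and> Ex t \<inter> set (ps i) \<noteq> {}} \<le> card {..j}"
        by (rule card_mono) auto
      then show ?thesis
        using True by simp
    next
      case False
      then have "{i. i \<le> j \<and> Ex t \<inter> set (ps i) \<noteq> {}} \<subset> {..j}"
        using \<open>t < R\<close> by (auto simp: J_def)
      then have "card {i. i \<le> j \<and> Ex t \<inter> set (ps i) \<noteq> {}} < card {..j}"
        by (intro psubset_card_mono) auto
      then show ?thesis
        using False by simp
    qed
    finally have "card (Ex t \<inter> \<Lambda>) \<le> j + of_bool (t \<in> J)" .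
    moreover have "card (Ex t) = card (Ex t - \<Lambda>) + card (Ex t \<inter> \<Lambda>)"
      using finEx[of t] card_Diff_subset_Int[of "Ex t" \<Lambda>] card_mono[of "Ex t" "Ex t \<inter> \<Lambda>"] by simp
    ultimately have "m \<le> card (Ex t - \<Lambda>) + j + of_bool (t \<in> J)"
      using busy by linarith
    then show ?thesis
      using False by (cases "t \<in> J") auto
  qed
  have indicator_sum: "(\<Sum>t<R. of_bool (t \<in> A)) = int (card A)" if "A \<subseteq> {..<R}" for A
    using that by (simp add: of_bool_def sum.If_cases inf_absorb2)
  have sI: "(\<Sum>t<R. of_bool (t \<in> I)) = int (card I)"
    and sJ: "(\<Sum>t<R. of_bool (t \<in> J)) = int (card J)"
    by (rule indicator_sum; auto simp: I_def J_def)+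
  have "(int m - int j) * (int R - int (card I)) + int (card I) - int (card J) =
    (\<Sum>t<R. (int m - int j) * (1 - of_bool (t \<in> I)) + of_bool (t \<in> I) - of_bool (t \<in> J))"
    using sI sJ by (simp add: sum.distrib sum_subtractf sum_distrib_left[symmetric])
  also have "\<dots> \<le> (\<Sum>t<R. int (card (Ex t - \<Lambda>)))"
    using unit by (intro sum_mono) auto
  also have "\<dots> = int (\<Sum>t<R. card {v \<in> verts G - \<Lambda>. t \<in> exec_units X m v})"
  proof -
    have "Ex t - \<Lambda> = {v \<in> verts G - \<Lambda>. t \<in> exec_units X m v}" for t
      using ExV[of t] by (auto simp: Ex_def)
    then show ?thesis
      by simp
  qed
  also have "\<dots> \<le> int (vol G (verts G - \<Lambda>))"
    using finite_verts by (intro of_nat_mono sum_card_executing_le) auto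
  also have "\<dots> = int (vol G (verts G)) - int (vol G \<Lambda>)"
    using sum.subset_diff[OF Lam finite_verts, of "wcet G"] by (simp add: vol_def)
  \<comment> \<open>Disjointness of the paths makes the volume additive.\<close>
  also have "vol G \<Lambda> = (\<Sum>i=0..j. len G (ps i))"
    unfolding vol_def len_def \<Lambda>_def atLeast0AtMost using gpl
    by (intro sum.UNION_disjoint) (auto simp: generalized_path_list_def disjoint_family_on_def)
  finally have main: "(int m - int j) * (int R - int (card I)) + int (card I) - int (card J)
    \<le> int (vol G (verts G)) - (\<Sum>i=0..j. int (len G (ps i)))"
    by simp
  \<comment> \<open>Replacing \<open>card I\<close> by \<open>len_dag G\<close> in the product of
    \<open>main\<close> costs at least \<open>len_dag G - card I\<close>; this cancels
    \<open>card I\<close> and leaves \<open>len_dag G - card J\<close>, which is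
    nonnegative.\<close>
  have "1 * (int (len_dag G) - int (card I)) \<le> (int m - int j) * (int (len_dag G) - int (card I))"
    using I \<open>j < m\<close> by (intro mult_right_mono) auto
  then show ?thesis
    using main J by (simp add: R_def algebra_simps)
qed

end

section \<open>Passage to real quotients and their minimum\<close>

theorem theorem2:
  fixes G :: "'a dag" and X :: "'a exec_seq" and m k :: nat and ps :: "nat \<Rightarrow> 'a list"
  assumes "dag_task G"
    and "m \<ge> 1"
    and "k \<le> m - 1"
    and "generalized_path_list G k ps"
    and "longest_path G (ps 0)"
    and "work_conserving_execution G m X"
  shows "real (response_time G X) \<le>
    (MIN j\<in>{0..k}. real (len_dag G) +
       (real (vol G (verts G)) - (\<Sum>i=0..j. real (len G (ps i)))) / (real m - real j))"
proof -
  interpret dag_execution G m X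
    using assms(1,6) by (rule dag_execution.intro)
  have "real (response_time G X) \<le> real (len_dag G) +
    (real (vol G (verts G)) - (\<Sum>i=0..j. real (len G (ps i)))) / (real m - real j)"
    if "j \<le> k" for j
  proof -
    have j: "j < m"
      using that assms(2,3) by simp
    \<comment> \<open>The first \<open>j + 1\<close> paths form a generalized path list on their
      own.\<close>
    have "generalized_path_list G j ps"
      using assms(4) that
      by (auto simp: generalized_path_list_def elim: disjoint_family_on_mono[rotated])
    then have "real_of_int ((int m - int j) * (int (response_time G X) - int (len_dag G))) \<le>
      real_of_int (int (vol G (verts G)) - (\<Sum>i=0..j. int (len G (ps i))))"
      using response_time_bound[OF _ j, of ps] by (subst of_int_le_iff)
    then have "(real m - real j) * (real (response_time G X) - real (len_dag G)) \<le>
      real (vol G (verts G)) - (\<Sum>i=0..j. real (len G (ps i)))"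
      by simp
    then show ?thesis
      using j by (simp add: field_simps)
  qed
  then show ?thesis
    by (subst Min_ge_iff) auto
qed

end
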